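(* Let $w\ge 4$ be an even integer and $u=w-2$. Then $$\sum_{\substack{a+b+c=w\\ a\ge 2,\ b,c\ge1}}\big[(-1)^c-(-1)^a\big]\,\zeta(a,b,c)=\frac12\zeta(w)-\zeta(2)\zeta(u).$$
   Context: Multiple zeta values: for positive integers $s_1\ge2, s_2,\dots,s_d$, $\zeta(s_1,\dots,s_d)=\sum_{k_1>\cdots>k_d>0}k_1^{-s_1}\cdots k_d^{-s_d}$. *)

theory Defs
  imports "HOL-Analysis.Analysis"
begin

text \<open>
  The multiple zeta value of the exponent list \<open>s = [s\<^sub>1, \<dots>, s\<^sub>d]\<close>, with summation indices
  \<open>k\<^sub>1 > \<dots> > k\<^sub>d > 0\<close> (largest index first). The terms are nonnegative, so the unordered sum is the
  usual one; it is meaningful when all \<open>s\<^sub>i\<close> are positive and \<open>s\<^sub>1 \<ge> 2\<close>.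
\<close>
definition mzv :: "nat list \<Rightarrow> real" where
  "mzv s = (\<Sum>\<^sub>\<infinity>k\<in>{k :: nat list. length k = length s \<and> sorted_wrt (>) k \<and> (\<forall>n\<in>set k. 0 < n)}.
     \<Prod>i<length s. 1 / real (k ! i) ^ (s ! i))"

end

theory Submission
  imports Defs
begin

text \<open>
  Fix \<open>k > m > n > 0\<close>. For even weight the signed sum of \<open>k^-a m^-b n^-c\<close> over all exponents is the
  difference of the unsigned sums at \<open>(k, m, -n)\<close> and \<open>(k, -m, -n)\<close>, each a monomial times a complete
  homogeneous polynomial in the reciprocals. Partial fractions turn it into
  \<open>\<alpha> k^-u - \<beta> m^-u + \<beta>' m^-u - \<gamma> n^-u\<close>, where the four coefficients are nonnegative and do not depend
  on the weight; so each part may be summed separately in any order. Fixing the index that carries the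
  exponent \<open>u\<close> to be \<open>N\<close> and summing over the other two gives, with \<open>P = H_N (H_(2N-1) - H_N)\<close>,
  \<open>Q = (H_(2N) - H_N) H_(N-1)\<close> and \<open>T_N = \<Sum>k\<le>N. 1 / k^2\<close>, the values \<open>P - T_(N-1) / 2\<close>, \<open>P\<close>, \<open>Q\<close> and
  \<open>\<zeta>(2) + Q - T_N / 2\<close>. Hence the total coefficient of \<open>N^-u\<close> is \<open>1 / (2 N^2) - \<zeta>(2)\<close>.
\<close>

subsection \<open>Finite harmonic sums\<close>

definition gen_harm :: "nat \<Rightarrow> nat \<Rightarrow> real" where
  "gen_harm s n = (\<Sum>k=1..n. 1 / real k ^ s)"

lemma gen_harm_0 [simp]: "gen_harm s 0 = 0"
  by (simp add: gen_harm_def)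

lemma gen_harm_Suc: "gen_harm s (Suc n) = gen_harm s n + 1 / real (Suc n) ^ s"
  by (simp add: gen_harm_def)

lemma gen_harm_nonneg: "0 \<le> gen_harm s n"
  by (simp add: gen_harm_def sum_nonneg)

lemma harm_eq_sum: "harm n = (\<Sum>k=1..n. 1 / real k)"
  by (simp add: harm_def inverse_eq_divide)

lemma harm_pred:
  assumes "n \<ge> 1"
  shows   "harm (n - 1) = harm n - 1 / real n"
  using assms by (cases n) (simp_all add: harm_Suc inverse_eq_divide)

lemma sum_atLeastLessThan_shift:
  fixes f :: "nat \<Rightarrow> 'a :: ab_group_add"
  shows "(\<Sum>j=1..<Suc n. f (m + j)) = (\<Sum>k=1..m + n. f k) - (\<Sum>k=1..m. f k)"
  by (induction n) (simp_all add: algebra_simps)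

lemma sum_atLeastLessThan_double:
  fixes f :: "nat \<Rightarrow> 'a :: ab_group_add"
  assumes "N \<ge> 1"
  shows   "(\<Sum>j=1..<N. f (N + j)) = (\<Sum>k=1..2 * N. f k) - (\<Sum>k=1..N. f k) - f (2 * N)"
proof -
  obtain M where N_eq: "N = Suc M" using assms by (cases N) auto
  have "{1..2 * N} = insert (2 * N) {1..N + M}" using N_eq by auto
  hence "(\<Sum>k=1..2 * N. f k) = (\<Sum>k=1..N + M. f k) + f (2 * N)" using N_eq by simp
  thus ?thesis using sum_atLeastLessThan_shift[where f = f and m = N and n = M]
    unfolding N_eq[symmetric] by simp
qed

lemma sum_inverse_add:
  assumes "n \<ge> 1"
  shows   "(\<Sum>j=1..<n. 1 / (real m + real j)) = harm (m + n - 1) - harm m"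
  using assms sum_atLeastLessThan_shift[where f = "\<lambda>k. 1 / real k" and m = m and n = "n - 1"]
  by (cases n) (simp_all add: harm_eq_sum)

lemma sum_inverse_diff: "(\<Sum>j=1..<n. 1 / (real n - real j)) = harm (n - 1)"
proof -
  have "(\<Sum>j=1..<n. 1 / (real n - real j)) = (\<Sum>i=1..n - 1. 1 / real i)"
    by (rule sum.reindex_bij_witness[of _ "\<lambda>i. n - i" "\<lambda>j. n - j"]) (auto simp: of_nat_diff)
  thus ?thesis by (simp add: harm_eq_sum)
qed

lemma sum_inverse_product_diff:
  assumes "m \<le> n"
  shows "(\<Sum>j=1..<m. 1 / ((real n + real j) * (real n - real j)))
    = ((\<Sum>j=1..<m. 1 / (real n + real j)) + (\<Sum>j=1..<m. 1 / (real n - real j))) / (2 * real n)"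
proof -
  have "1 / ((real n + real j) * (real n - real j))
      = (1 / (real n + real j) + 1 / (real n - real j)) / (2 * real n)" if "j \<in> {1..<m}" for j
  proof -
    have "real n + real j \<noteq> 0" "real n - real j \<noteq> 0" "real n \<noteq> 0" using that assms by auto
    thus ?thesis by (simp add: divide_simps)
  qed
  thus ?thesis by (simp only: sum.distrib sum_divide_distrib[symmetric] cong: sum.cong)
qed

lemma sum_harm_div:
  "(\<Sum>k=1..n. harm k / real k) = (harm n ^ 2 + gen_harm 2 n) / 2"
proof (induction n)
  case (Suc n)
  have "(\<Sum>k=1..Suc n. harm k / real k) = (harm n ^ 2 + gen_harm 2 n) / 2 + harm (Suc n) / real (Suc n)"
    using Suc.IH by simp
  also have "\<dots> = (harm (Suc n) ^ 2 + gen_harm 2 (Suc n)) / 2"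
    unfolding harm_Suc gen_harm_Suc by (simp add: field_simps power2_eq_square del: of_nat_Suc)
  finally show ?case .
qed (simp add: harm_def)

lemma sum_harm_convolution:
  "(\<Sum>i=1..<n. harm (n - i) / real i) = harm n ^ 2 - gen_harm 2 n"
proof (induction n)
  case (Suc n)
  have "(\<Sum>i=1..<Suc n. harm (Suc n - i) / real i)
      = (\<Sum>i=1..<Suc n. harm (n - i) / real i + (1 / real i + 1 / (real (Suc n) - real i)) / real (Suc n))"
  proof (intro sum.cong refl)
    fix i assume i_in: "i \<in> {1..<Suc n}"
    hence "Suc n - i = Suc (n - i)" and nonzero: "real i \<noteq> 0" "real (Suc n) - real i \<noteq> 0" by auto
    hence "harm (Suc n - i) / real i = harm (n - i) / real i + 1 / (real i * (real (Suc n) - real i))"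
      using i_in by (simp add: harm_Suc of_nat_diff inverse_eq_divide add_divide_distrib mult.commute)
    also have "1 / (real i * (real (Suc n) - real i))
        = (1 / real i + 1 / (real (Suc n) - real i)) / real (Suc n)"
      using nonzero by (simp add: add_frac_eq del: of_nat_Suc)
    finally show "harm (Suc n - i) / real i
        = harm (n - i) / real i + (1 / real i + 1 / (real (Suc n) - real i)) / real (Suc n)" .
  qed
  also have "\<dots> = (\<Sum>i=1..<Suc n. harm (n - i) / real i)
      + ((\<Sum>i=1..<Suc n. 1 / real i) + (\<Sum>i=1..<Suc n. 1 / (real (Suc n) - real i))) / real (Suc n)"
    by (simp only: sum.distrib sum_divide_distrib[symmetric])
  also have "(\<Sum>i=1..<Suc n. harm (n - i) / real i) = harm n ^ 2 - gen_harm 2 n"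
    using Suc.IH by (cases n) (simp_all add: harm_def)
  also have "(\<Sum>i=1..<Suc n. 1 / real i) = harm n"
    by (simp add: harm_eq_sum atLeastLessThanSuc_atLeastAtMost)
  also have "harm n ^ 2 - gen_harm 2 n
      + (harm n + (\<Sum>i=1..<Suc n. 1 / (real (Suc n) - real i))) / real (Suc n)
      = harm (Suc n) ^ 2 - gen_harm 2 (Suc n)"
    unfolding sum_inverse_diff harm_Suc gen_harm_Suc
    by (simp add: field_simps power2_eq_square del: of_nat_Suc)
  finally show ?case .
qed (simp add: harm_def)

text \<open>With \<open>i = N - j\<close>, the sum runs over the points with \<open>i < N\<close> of the triangle \<open>i + l \<le> 2 N\<close>,
  weighted by \<open>1 / (i l)\<close>. Together with its mirror image it covers the triangle except for the point
  \<open>(N, N)\<close>, and the square \<open>i, l < N\<close> twice.\<close>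
lemma sum_harm_add_div_diff:
  assumes "N \<ge> 1"
  shows   "(\<Sum>j=1..<N. harm (N + j) / (real N - real j))
             = (harm (2 * N) ^ 2 - gen_harm 2 (2 * N) + harm (N - 1) ^ 2 - 1 / real N ^ 2) / 2"
proof -
  define f where "f = (\<lambda>(i, l). 1 / (real i * real l))"
  define T where "T I = Sigma I (\<lambda>i. {1..2 * N - i})" for I
  define A B where "A = T {1..<N}" and "B = prod.swap ` A"
  have sum_T: "sum f (T I) = (\<Sum>i\<in>I. harm (2 * N - i) / real i)" if "finite I" for I
    using that by (simp add: T_def f_def harm_eq_sum sum_divide_distrib mult.commute flip: sum.Sigma)
  have fin: "finite A" "finite B" by (simp_all add: A_def B_def T_def)
  have "sum f (A \<union> B) = sum f (T {1..<2 * N}) - 1 / real N ^ 2"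
  proof -
    have "A \<union> B = T {1..<2 * N} - {(N, N)}" by (force simp: A_def B_def T_def)
    moreover have "(N, N) \<in> T {1..<2 * N}" using assms by (auto simp: T_def)
    ultimately show ?thesis by (simp add: sum_diff1 T_def f_def power2_eq_square)
  qed
  hence union: "sum f (A \<union> B) = harm (2 * N) ^ 2 - gen_harm 2 (2 * N) - 1 / real N ^ 2"
    by (simp only: sum_T finite_atLeastLessThan sum_harm_convolution)
  have "A \<inter> B = {1..N - 1} \<times> {1..N - 1}" by (force simp: A_def B_def T_def)
  hence inter: "sum f (A \<inter> B) = harm (N - 1) ^ 2"
    by (simp add: f_def harm_eq_sum power2_eq_square sum_product sum.cartesian_product)
  have "sum f B = sum f A"
    unfolding B_def by (subst sum.reindex) (auto simp: f_def mult.commute intro!: sum.cong)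
  hence "2 * sum f A = sum f (A \<union> B) + sum f (A \<inter> B)"
    using sum.union_inter[OF fin, of f] by simp
  also have "sum f A = (\<Sum>j=1..<N. harm (N + j) / (real N - real j))"
    unfolding A_def sum_T[OF finite_atLeastLessThan]
    by (rule sum.reindex_bij_witness[of _ "\<lambda>j. N - j" "\<lambda>i. N - i"])
       (auto simp: of_nat_diff intro!: arg_cong[of _ _ harm])
  finally show ?thesis by (simp add: union inter)
qed

lemma sum_harm_add_div_add:
  assumes "N \<ge> 1"
  shows   "(\<Sum>j=1..<N. harm (N + j) / (real N + real j))
             = (harm (2 * N) ^ 2 + gen_harm 2 (2 * N) - harm N ^ 2 - gen_harm 2 N) / 2
               - harm (2 * N) / (2 * real N)"
  using sum_atLeastLessThan_double[OF assms, of "\<lambda>k. harm k / real k"]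
  unfolding sum_harm_div by (simp add: diff_divide_distrib add_divide_distrib)

lemma sum_harm_add_weighted:
  assumes "N \<ge> 1"
  shows   "(\<Sum>m=1..<N. harm (N + m) * (1 / (real N - real m) - 1 / (real N + real m)))
             = harm N * harm (N - 1) + harm (2 * N) / (2 * real N) + gen_harm 2 N / 2 - gen_harm 2 (2 * N)"
proof -
  have "(\<Sum>m=1..<N. harm (N + m) * (1 / (real N - real m) - 1 / (real N + real m)))
      = (\<Sum>m=1..<N. harm (N + m) / (real N - real m)) - (\<Sum>m=1..<N. harm (N + m) / (real N + real m))"
    by (simp add: right_diff_distrib sum_subtractf)
  also have "\<dots> = harm N * harm (N - 1) + harm (2 * N) / (2 * real N) + gen_harm 2 N / 2 - gen_harm 2 (2 * N)"
    unfolding sum_harm_add_div_diff[OF assms] sum_harm_add_div_add[OF assms] harm_pred[OF assms]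
    using assms by (simp add: field_simps power2_eq_square)
  finally show ?thesis .
qed

lemma sum_inverse_add_weighted:
  assumes "N \<ge> 1"
  shows   "(\<Sum>m=1..<N. 1 / (real N + real m) * (1 / (real N - real m) - 1 / (real N + real m)))
             = harm (2 * N) / (2 * real N) + gen_harm 2 N - gen_harm 2 (2 * N) - 1 / (2 * real N ^ 2)"
proof -
  have squares: "(\<Sum>m=1..<N. 1 / (real N + real m) ^ 2)
      = gen_harm 2 (2 * N) - gen_harm 2 N - 1 / (4 * real N ^ 2)"
    using sum_atLeastLessThan_double[OF assms, of "\<lambda>k. 1 / real k ^ 2"]
    by (simp add: gen_harm_def power_mult_distrib)
  have pred: "harm (2 * N - 1) = harm (2 * N) - 1 / (2 * real N)"
    using harm_pred[of "2 * N"] assms by simp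
  have "(\<Sum>m=1..<N. 1 / (real N + real m) * (1 / (real N - real m) - 1 / (real N + real m)))
      = (\<Sum>m=1..<N. 1 / ((real N + real m) * (real N - real m))) - (\<Sum>m=1..<N. 1 / (real N + real m) ^ 2)"
    by (simp add: right_diff_distrib sum_subtractf power2_eq_square)
  also have "\<dots> = harm (2 * N) / (2 * real N) + gen_harm 2 N - gen_harm 2 (2 * N) - 1 / (2 * real N ^ 2)"
    unfolding squares sum_inverse_product_diff[OF order_refl] sum_inverse_add[OF assms] sum_inverse_diff
      mult_2[symmetric] harm_pred[OF assms] pred
    using assms by (simp add: field_simps power2_eq_square)
  finally show ?thesis .
qed

lemma sum_harm_diff_weighted:
  assumes "N \<ge> 1"
  shows   "(\<Sum>m=1..<N. (1 / (real N - real m) - 1 / (real N + real m)) * (harm (N + m - 1) - harm N))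
             = harm N * (harm (2 * N - 1) - harm N) - gen_harm 2 (N - 1) / 2"
proof -
  define v where "v m = 1 / (real N - real m) - 1 / (real N + real m)" for m
  have "(\<Sum>m=1..<N. v m * (harm (N + m - 1) - harm N))
      = (\<Sum>m=1..<N. harm (N + m) * v m - 1 / (real N + real m) * v m - harm N * v m)"
  proof (intro sum.cong refl)
    fix m assume "m \<in> {1..<N}"
    hence "harm (N + m - 1) = harm (N + m) - 1 / (real N + real m)"
      using harm_pred[of "N + m"] by simp
    thus "v m * (harm (N + m - 1) - harm N) = harm (N + m) * v m - 1 / (real N + real m) * v m - harm N * v m"
      by (simp only:) (simp add: algebra_simps)
  qed
  also have "\<dots> = (\<Sum>m=1..<N. harm (N + m) * v m) - (\<Sum>m=1..<N. 1 / (real N + real m) * v m)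
      - harm N * (\<Sum>m=1..<N. v m)"
    by (simp only: sum_subtractf sum_distrib_left)
  also have "(\<Sum>m=1..<N. v m) = harm (N - 1) - (harm (2 * N - 1) - harm N)"
    unfolding v_def sum_subtractf sum_inverse_diff sum_inverse_add[OF assms] mult_2[symmetric] ..
  also have "(\<Sum>m=1..<N. harm (N + m) * v m) - (\<Sum>m=1..<N. 1 / (real N + real m) * v m)
      = harm N * harm (N - 1) - (gen_harm 2 N - 1 / real N ^ 2) / 2"
    unfolding v_def sum_harm_add_weighted[OF assms] sum_inverse_add_weighted[OF assms]
    by (simp add: diff_divide_distrib)
  also have "gen_harm 2 N - 1 / real N ^ 2 = gen_harm 2 (N - 1)"
    using assms by (cases N) (simp_all add: gen_harm_Suc)
  finally show ?thesis by (simp add: v_def algebra_simps)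
qed

lemma sum_harm_div_add_harm_diff:
  assumes "N \<ge> 1"
  shows   "(\<Sum>j=1..N. harm (N + j) / (real N + real j))
             + (\<Sum>j=1..<N. (harm (2 * N) - harm (N + j)) / (real N - real j))
           = (harm (2 * N) - harm N) * harm (N - 1) + gen_harm 2 (2 * N) - gen_harm 2 N / 2"
proof -
  have "(\<Sum>j=1..N. harm (N + j) / (real N + real j))
      = (\<Sum>j=1..<N. harm (N + j) / (real N + real j)) + harm (2 * N) / (2 * real N)"
    using assms by (cases N) (simp_all add: atLeastLessThanSuc_atLeastAtMost flip: mult_2)
  hence "(\<Sum>j=1..N. harm (N + j) / (real N + real j))
      + (\<Sum>j=1..<N. (harm (2 * N) - harm (N + j)) / (real N - real j))
    = harm (2 * N) * (\<Sum>j=1..<N. 1 / (real N - real j)) + harm (2 * N) / (2 * real N)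
      - (\<Sum>j=1..<N. harm (N + j) * (1 / (real N - real j) - 1 / (real N + real j)))"
    by (simp add: right_diff_distrib diff_divide_distrib sum_subtractf sum_distrib_left)
  thus ?thesis
    unfolding sum_harm_add_weighted[OF assms] sum_inverse_diff by (simp add: algebra_simps)
qed

lemma harm_ge_1:
  assumes "0 < n"
  shows   "1 \<le> (harm n :: real)"
  using harm_mono[of 1 n, where 'a = real] assms by (simp add: harm_expand)

lemma mult_harm_le_harm_squared:
  assumes "1 \<le> N" "c \<le> 1"
  shows   "c * harm N \<le> (harm N ^ 2 :: real)"
  using assms harm_ge_1[of N] by (simp add: power2_eq_square mult_right_mono)

lemma harm_le_powr:
  fixes e :: real
  assumes "0 < n" "0 < e"
  shows   "harm n \<le> (1 + 1 / e) * real n powr e"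
proof -
  have "harm n - ln (real n) \<le> 1"
    using euler_mascheroni_sequence_decreasing[of 1 n] assms by (simp add: harm_expand)
  moreover have "ln (real n) \<le> real n powr e / e"
    using assms by (intro ln_powr_bound) auto
  moreover have "1 \<le> real n powr e"
    using assms by (intro ge_one_powr_ge_zero) auto
  ultimately show ?thesis by (simp add: algebra_simps)
qed

lemma harm_add_diff_le:
  assumes "0 < m"
  shows   "harm (m + n) - harm m \<le> real n / real m"
proof -
  have "harm (m + n) - harm m = (\<Sum>j=1..<Suc n. 1 / (real m + real j))"
    using sum_inverse_add[of "Suc n" m] by simp
  also have "\<dots> \<le> (\<Sum>j=1..<Suc n. 1 / real m)"
    using assms by (intro sum_mono) (simp add: frac_le)
  finally show ?thesis by simp
qed

lemma harm_double_diff_le: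
  assumes "1 \<le> N"
  shows   "harm (2 * N) - harm N \<le> (1 :: real)"
  using harm_add_diff_le[of N N] assms by (simp flip: mult_2)

lemma harm_double_pred_diff_le:
  assumes "1 \<le> N"
  shows   "harm (2 * N - 1) - harm N \<le> (1 :: real)"
  using harm_double_diff_le[OF assms] harm_mono[of "2 * N - 1" "2 * N", where 'a = real] by simp

subsection \<open>Infinite sums over positive integers\<close>

lemma has_sum_SigmaI_nonneg:
  fixes f :: "'a \<times> 'b \<Rightarrow> real"
  assumes "\<And>x. x \<in> A \<Longrightarrow> ((\<lambda>y. f (x, y)) has_sum g x) (B x)" and "(g has_sum s) A"
    and "\<And>x y. x \<in> A \<Longrightarrow> y \<in> B x \<Longrightarrow> 0 \<le> f (x, y)"
  shows "(f has_sum s) (Sigma A B)"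
  using assms
  by (intro has_sum_SigmaI[where g = g] summable_on_SigmaI[where g = g] has_sum_imp_summable[of g])

lemma has_sum_Times_nonneg:
  fixes f :: "'a \<Rightarrow> real" and g :: "'b \<Rightarrow> real"
  assumes "(f has_sum s) A" "(g has_sum t) B"
    and "\<And>x. x \<in> A \<Longrightarrow> 0 \<le> f x" "\<And>y. y \<in> B \<Longrightarrow> 0 \<le> g y"
  shows "((\<lambda>(x, y). f x * g y) has_sum s * t) (A \<times> B)"
  using assms by (intro has_sum_SigmaI_nonneg[where g = "\<lambda>x. f x * t"])
    (auto intro: has_sum_cmult_right has_sum_cmult_left)

lemma has_sum_sum:
  fixes f :: "'i \<Rightarrow> 'a \<Rightarrow> 'b :: topological_comm_monoid_add"
  assumes "finite I" and "\<And>i. i \<in> I \<Longrightarrow> (f i has_sum s i) A"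
  shows   "((\<lambda>x. \<Sum>i\<in>I. f i x) has_sum (\<Sum>i\<in>I. s i)) A"
  using assms by (induction I rule: finite_induct) (auto intro: has_sum_add)

lemma has_sum_diff:
  fixes f g :: "'a \<Rightarrow> 'b :: topological_ab_group_add"
  assumes "(f has_sum s) A" "(g has_sum t) A"
  shows   "((\<lambda>x. f x - g x) has_sum (s - t)) A"
  using has_sum_add[OF assms(1), of "\<lambda>x. - g x" "- t"] assms(2)
  by (simp add: has_sum_uminus)

lemma has_sum_greaterThan_shift:
  fixes f :: "nat \<Rightarrow> 'a :: {comm_monoid_add, topological_space}"
  shows "(f has_sum s) {m<..} \<longleftrightarrow> ((\<lambda>p. f (m + p)) has_sum s) {0<..}"
  by (rule has_sum_reindex_bij_witness[of _ "\<lambda>p. m + p" "\<lambda>k. k - m"]) auto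

lemma has_sum_positiveI:
  fixes f :: "nat \<Rightarrow> real"
  assumes "(\<lambda>p. f (Suc p)) sums s" and "\<And>p. 0 < p \<Longrightarrow> 0 \<le> f p"
  shows   "(f has_sum s) {0<..}"
proof -
  have "((\<lambda>p. f (Suc p)) has_sum s) UNIV"
    using assms by (intro sums_nonneg_imp_has_sum) auto
  also have "?this \<longleftrightarrow> ?thesis"
    by (rule has_sum_reindex_bij_witness[of _ "\<lambda>p. p - 1" Suc]) auto
  finally show ?thesis .
qed

lemma tendsto_harm_add_diff: "(\<lambda>K. harm (K + n) - harm K :: real) \<longlonglongrightarrow> 0"
proof (rule tendsto_sandwich)
  show "\<forall>\<^sub>F K in sequentially. 0 \<le> (harm (K + n) - harm K :: real)"
    by (simp add: harm_mono)
  show "\<forall>\<^sub>F K in sequentially. harm (K + n) - harm K \<le> real n / real K"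
    using eventually_gt_at_top[of 0] by eventually_elim (rule harm_add_diff_le)
  show "(\<lambda>K. real n / real K) \<longlonglongrightarrow> 0" by (rule lim_const_over_n)
qed simp

lemma sums_inverse_diff:
  "(\<lambda>p. 1 / (real (Suc p) + real q) - 1 / (real (Suc p) + real r)) sums (harm r - harm q)"
proof -
  have "(\<Sum>p<K. 1 / (real (Suc p) + real q) - 1 / (real (Suc p) + real r))
      = harm r - harm q + ((harm (K + q) - harm K) - (harm (K + r) - harm K))" for K
    by (induction K) (simp_all add: harm_Suc inverse_eq_divide add_ac)
  moreover have "(\<lambda>K. harm r - harm q + ((harm (K + q) - harm K) - (harm (K + r) - harm K) :: real))
      \<longlonglongrightarrow> harm r - harm q + (0 - 0)"
    by (intro tendsto_intros tendsto_harm_add_diff)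
  ultimately show ?thesis by (simp add: sums_def)
qed

lemma has_sum_inverse_diff:
  assumes "q \<le> r"
  shows "((\<lambda>p. 1 / (real p + real q) - 1 / (real p + real r)) has_sum (harm r - harm q)) {0<..}"
  using assms by (intro has_sum_positiveI sums_inverse_diff) (simp add: frac_le)

lemma has_sum_inverse_product:
  assumes "q \<noteq> r"
  shows "((\<lambda>p. 1 / (real p + real q) * (1 / (real p + real r)))
           has_sum ((harm r - harm q) / (real r - real q))) {0<..}"
proof (rule has_sum_positiveI)
  have "1 / (real (Suc p) + real q) * (1 / (real (Suc p) + real r))
      = (1 / (real (Suc p) + real q) - 1 / (real (Suc p) + real r)) / (real r - real q)" for p
  proof -
    have "real r - real q \<noteq> 0" "real (Suc p) + real q \<noteq> 0" "real (Suc p) + real r \<noteq> 0"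
      using assms by linarith+
    thus ?thesis by (simp add: divide_simps)
  qed
  thus "(\<lambda>p. 1 / (real (Suc p) + real q) * (1 / (real (Suc p) + real r)))
      sums ((harm r - harm q) / (real r - real q))"
    by (simp only: sums_divide[OF sums_inverse_diff])
qed simp

lemma summable_on_div_power_if_le_harm_squared:
  fixes g :: "nat \<Rightarrow> real"
  assumes "2 \<le> s" and "\<And>n. 0 < n \<Longrightarrow> 0 \<le> g n" and "\<And>n. 0 < n \<Longrightarrow> g n \<le> C * harm n ^ 2"
  shows   "(\<lambda>n. g n / real n ^ s) summable_on {0<..}"
proof (rule summable_on_comparison_test)
  have "summable (\<lambda>n. real n powr (-3/2))" by (subst summable_real_powr_iff) simp
  hence "(\<lambda>n. real n powr (-3/2)) summable_on {0<..}"
    by (intro summable_on_subset_banach[OF summable_nonneg_imp_summable_on]) auto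
  thus "(\<lambda>n. C * 25 * real n powr (-3/2)) summable_on {0<..}"
    by (rule summable_on_cmult_right)
  fix n :: nat assume "n \<in> {0<..}"
  hence pos: "0 < n" by simp
  have "0 \<le> C" using assms(2)[of 1] assms(3)[of 1] by (simp add: harm_expand)
  have "harm n \<le> 5 * real n powr (1/4)" using harm_le_powr[of n "1/4"] pos by simp
  hence "harm n ^ 2 \<le> (5 * real n powr (1/4)) ^ 2" by (intro power_mono harm_nonneg)
  also have "\<dots> = 25 * real n powr (1/2)"
    by (simp add: power_mult_distrib power2_eq_square flip: powr_add)
  finally have "g n \<le> C * (25 * real n powr (1/2))"
    using assms(3)[OF pos] mult_left_mono[OF _ \<open>0 \<le> C\<close>] by (meson order_trans)
  moreover have "real n ^ 2 \<le> real n ^ s" using pos assms(1) by (intro power_increasing) auto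
  ultimately have "g n / real n ^ s \<le> C * (25 * real n powr (1/2)) / real n ^ 2"
    using pos assms(2)[OF pos] by (intro frac_le) auto
  also have "\<dots> = C * 25 * (real n powr (1/2) * real n powr (-2))"
    using pos by (simp add: powr_minus_divide)
  also have "\<dots> = C * 25 * real n powr (-3/2)" by (simp flip: powr_add)
  finally show "g n / real n ^ s \<le> C * 25 * real n powr (-3/2)" .
  show "0 \<le> g n / real n ^ s" using assms(2)[OF pos] by simp
qed

lemma has_sum_Sigma_div_power:
  fixes f :: "nat \<Rightarrow> 'a \<Rightarrow> real"
  assumes "2 \<le> s"
    and has_sum: "\<And>n. 0 < n \<Longrightarrow> (f n has_sum g n) (B n)"
    and nonneg: "\<And>n y. 0 < n \<Longrightarrow> y \<in> B n \<Longrightarrow> 0 \<le> f n y"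
    and "\<And>n. 0 < n \<Longrightarrow> g n \<le> C * harm n ^ 2"
  obtains S where "((\<lambda>(n, y). f n y / real n ^ s) has_sum S) (Sigma {0<..} B)"
    and "((\<lambda>n. g n / real n ^ s) has_sum S) {0<..}"
proof
  define S where "S = (\<Sum>\<^sub>\<infinity>n\<in>{0<..}. g n / real n ^ s)"
  have "0 \<le> g n" if "0 < n" for n using has_sum_nonneg[OF has_sum] nonneg that by blast
  hence "(\<lambda>n. g n / real n ^ s) summable_on {0<..}"
    using assms by (intro summable_on_div_power_if_le_harm_squared) auto
  thus sum: "((\<lambda>n. g n / real n ^ s) has_sum S) {0<..}" by (simp add: S_def)
  show "((\<lambda>(n, y). f n y / real n ^ s) has_sum S) (Sigma {0<..} B)"
  proof (rule has_sum_SigmaI_nonneg[OF _ sum])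
    show "((\<lambda>y. case (n, y) of (n, y) \<Rightarrow> f n y / real n ^ s) has_sum g n / real n ^ s) (B n)"
      if "n \<in> {0<..}" for n
      using has_sum_cmult_left[OF has_sum, of n "1 / real n ^ s"] that by simp
  qed (auto simp: nonneg)
qed

subsection \<open>Multiple zeta values of depth one and three\<close>

lemma has_sum_mzv_single:
  assumes "2 \<le> s"
  shows   "((\<lambda>n. 1 / real n ^ s) has_sum mzv [s]) {0<..}"
proof -
  have "mzv [s] = (\<Sum>\<^sub>\<infinity>n\<in>{0<..}. 1 / real n ^ s)"
    unfolding mzv_def
    by (rule infsum_reindex_bij_witness[of _ "\<lambda>n. [n]" "\<lambda>l. l ! 0"]) (auto simp: length_Suc_conv)
  moreover have "(\<lambda>n. 1 / real n ^ s) summable_on {0<..}"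
    using assms by (rule summable_on_div_power_if_le_harm_squared[where C = 1]) (simp_all add: harm_ge_1)
  ultimately show ?thesis by simp
qed

lemma has_sum_mzv_single_shift:
  assumes "2 \<le> s"
  shows   "((\<lambda>p. 1 / (real p + real q) ^ s) has_sum (mzv [s] - gen_harm s q)) {0<..}"
proof -
  have "((\<lambda>n. 1 / real n ^ s) has_sum (mzv [s] - gen_harm s q)) ({0<..} - {1..q})"
    using assms by (intro has_sum_Diff has_sum_mzv_single has_sum_finiteI) (auto simp: gen_harm_def)
  also have "{0<..} - {1..q} = {q<..}" by auto
  finally show ?thesis
    unfolding has_sum_greaterThan_shift[where m = q] by (simp add: add.commute)
qed

definition index_triples :: "(nat \<times> nat \<times> nat) set" where
  "index_triples = {(k, m, n). 0 < n \<and> n < m \<and> m < k}"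

lemma has_sum_index_triples_largest_first:
  "((\<lambda>(k, m, n). f k m n) has_sum s) index_triples
     \<longleftrightarrow> ((\<lambda>(k, m, n). f k m n) has_sum s) (SIGMA k:{0<..}. SIGMA m:{1..<k}. {1..<m})"
  by (rule has_sum_reindex_bij_witness[of _ id id]) (auto simp: index_triples_def)

lemma has_sum_index_triples_middle_first:
  "((\<lambda>(k, m, n). f k m n) has_sum s) index_triples
     \<longleftrightarrow> ((\<lambda>(m, k, n). f k m n) has_sum s) (SIGMA m:{0<..}. {m<..} \<times> {1..<m})"
  by (rule has_sum_reindex_bij_witness[of _ "\<lambda>(m, k, n). (k, m, n)" "\<lambda>(k, m, n). (m, k, n)"])
     (auto simp: index_triples_def)

lemma has_sum_index_triples_smallest_first:
  "((\<lambda>(k, m, n). f k m n) has_sum s) index_triples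
     \<longleftrightarrow> ((\<lambda>(n, m, k). f k m n) has_sum s) (SIGMA n:{0<..}. SIGMA m:{n<..}. {m<..})"
  by (rule has_sum_reindex_bij_witness[of _ "\<lambda>(n, m, k). (k, m, n)" "\<lambda>(k, m, n). (n, m, k)"])
     (auto simp: index_triples_def)

lemma summable_on_index_triples:
  assumes "2 \<le> a" "1 \<le> b" "1 \<le> c"
  shows   "(\<lambda>(k, m, n). 1 / (real k ^ a * real m ^ b * real n ^ c)) summable_on index_triples"
proof -
  define f where "f = (\<lambda>(m, n). 1 / (real m ^ b * real n ^ c))"
  define B where "B k = (SIGMA m:{1..<k}. {1..<m})" for k :: nat
  have bound: "sum f (B k) \<le> 1 * harm k ^ 2" for k
  proof -
    have "sum f (B k) \<le> (\<Sum>(m, n)\<in>B k. 1 / real m * (1 / real n))"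
    proof (rule sum_mono, clarify)
      fix m n assume "(m, n) \<in> B k"
      hence pos: "1 \<le> m" "1 \<le> n" by (auto simp: B_def)
      have "real m ^ 1 * real n ^ 1 \<le> real m ^ b * real n ^ c"
        using pos assms by (intro mult_mono power_increasing) auto
      thus "f (m, n) \<le> 1 / real m * (1 / real n)"
        using pos by (simp add: f_def frac_le)
    qed
    also have "\<dots> \<le> (\<Sum>(m, n)\<in>{1..k} \<times> {1..k}. 1 / real m * (1 / real n))"
      by (rule sum_mono2) (auto simp: B_def)
    also have "\<dots> = harm k ^ 2"
      by (simp add: harm_eq_sum power2_eq_square sum_product sum.cartesian_product)
    finally show ?thesis by simp
  qed
  obtain S where "((\<lambda>(k, y). f y / real k ^ a) has_sum S) (Sigma {0<..} B)"
  proof (rule has_sum_Sigma_div_power[OF assms(1)])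
    show "(f has_sum sum f (B k)) (B k)" for k by (simp add: B_def)
    show "0 \<le> f y" for y by (simp add: f_def case_prod_unfold)
    show "sum f (B k) \<le> 1 * harm k ^ 2" for k by (rule bound)
  qed
  also have "(\<lambda>(k, y). f y / real k ^ a) = (\<lambda>(k, m, n). 1 / (real k ^ a * real m ^ b * real n ^ c))"
    by (simp add: fun_eq_iff f_def mult_ac)
  finally show ?thesis
    unfolding summable_on_def has_sum_index_triples_largest_first B_def by blast
qed

lemma has_sum_mzv_triple:
  assumes "2 \<le> a" "1 \<le> b" "1 \<le> c"
  shows   "((\<lambda>(k, m, n). 1 / (real k ^ a * real m ^ b * real n ^ c)) has_sum mzv [a, b, c]) index_triples"
proof -
  have "mzv [a, b, c] = (\<Sum>\<^sub>\<infinity>(k, m, n)\<in>index_triples. 1 / (real k ^ a * real m ^ b * real n ^ c))"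
    unfolding mzv_def
    by (rule infsum_reindex_bij_witness[of _ "\<lambda>(k, m, n). [k, m, n]" "\<lambda>l. (l ! 0, l ! 1, l ! 2)"])
       (auto simp: index_triples_def length_Suc_conv eval_nat_numeral lessThan_Suc mult_ac)
  thus ?thesis using summable_on_index_triples[OF assms] by simp
qed

subsection \<open>Partial fractions\<close>

definition weight_triples :: "nat \<Rightarrow> (nat \<times> nat \<times> nat) set" where
  "weight_triples w = {(a, b, c). a + b + c = w \<and> a \<ge> 2 \<and> b \<ge> 1 \<and> c \<ge> 1}"

lemma finite_weight_triples: "finite (weight_triples w)"
  by (rule finite_subset[of _ "{..w} \<times> {..w} \<times> {..w}"]) (auto simp: weight_triples_def)

lemma sum_power_mult_power:
  fixes x y :: "'a :: field"
  assumes "x \<noteq> y"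
  shows   "(\<Sum>b\<le>d. x ^ (d - b) * y ^ b) = (x ^ (d + 1) - y ^ (d + 1)) / (x - y)"
  using diff_power_eq_sum[of y d x] assms by (simp add: lessThan_Suc_atMost field_simps)

definition complete_homogeneous :: "nat \<Rightarrow> 'a :: comm_semiring_1 \<Rightarrow> 'a \<Rightarrow> 'a \<Rightarrow> 'a" where
  "complete_homogeneous d x y z = (\<Sum>c\<le>d. \<Sum>b\<le>d - c. x ^ (d - c - b) * y ^ b * z ^ c)"

lemma complete_homogeneous_partial_fractions:
  fixes x y z :: "'a :: field"
  assumes "x \<noteq> y" "x \<noteq> z" "y \<noteq> z"
  shows "complete_homogeneous d x y z
      = x ^ (d + 2) / ((x - y) * (x - z)) + y ^ (d + 2) / ((y - x) * (y - z))
        + z ^ (d + 2) / ((z - x) * (z - y))"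
proof -
  have "complete_homogeneous d x y z
      = (\<Sum>c\<le>d. (x ^ (d - c + 1) - y ^ (d - c + 1)) / (x - y) * z ^ c)"
    by (simp only: complete_homogeneous_def sum_distrib_right[symmetric] sum_power_mult_power[OF assms(1)])
  also have "\<dots> = (x * (\<Sum>c\<le>d. x ^ (d - c) * z ^ c) - y * (\<Sum>c\<le>d. y ^ (d - c) * z ^ c)) / (x - y)"
    by (simp add: sum_distrib_left sum_subtractf sum_divide_distrib diff_divide_distrib
          left_diff_distrib mult.assoc)
  also have "\<dots> = x ^ (d + 2) / ((x - y) * (x - z)) + y ^ (d + 2) / ((y - x) * (y - z))
        + z ^ (d + 2) / ((z - x) * (z - y))"
  proof -
    have nonzero: "x - y \<noteq> 0" "x - z \<noteq> 0" "y - z \<noteq> 0" using assms by auto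
    have swap: "y - x = - (x - y)" "z - x = - (x - z)" "z - y = - (y - z)" by simp_all
    show ?thesis
      unfolding sum_power_mult_power[OF assms(2)] sum_power_mult_power[OF assms(3)] swap
      using nonzero by (simp add: divide_simps) (simp add: algebra_simps)
  qed
  finally show ?thesis .
qed

lemma sum_weight_triples:
  fixes x y z :: "'a :: comm_semiring_1"
  shows "(\<Sum>(a, b, c)\<in>weight_triples (d + 4). x ^ a * y ^ b * z ^ c)
      = x ^ 2 * y * z * complete_homogeneous d x y z"
proof -
  have "(\<Sum>(a, b, c)\<in>weight_triples (d + 4). x ^ a * y ^ b * z ^ c)
      = (\<Sum>(c, b)\<in>(SIGMA c:{..d}. {..d - c}). x ^ (d - c - b + 2) * y ^ (b + 1) * z ^ (c + 1))"
    by (rule sym, rule sum.reindex_bij_witness[of _ "\<lambda>(a, b, c). (c - 1, b - 1)"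
          "\<lambda>(c, b). (d - c - b + 2, b + 1, c + 1)"])
       (auto simp: weight_triples_def)
  also have "\<dots> = x ^ 2 * y * z * complete_homogeneous d x y z"
    by (simp add: complete_homogeneous_def sum.Sigma sum_distrib_left case_prod_unfold
          power_add power2_eq_square mult_ac)
  finally show ?thesis .
qed

definition weight_sum :: "nat \<Rightarrow> 'a :: field \<Rightarrow> 'a \<Rightarrow> 'a \<Rightarrow> 'a" where
  "weight_sum w x y z = (\<Sum>(a, b, c)\<in>weight_triples w. 1 / (x ^ a * y ^ b * z ^ c))"

lemma weight_sum_partial_fractions:
  fixes x y z :: "'a :: field"
  assumes "x \<noteq> 0" "y \<noteq> 0" "z \<noteq> 0" "x \<noteq> y" "x \<noteq> z" "y \<noteq> z"
  shows "weight_sum (d + 4) x y z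
      = 1 / (x - y) * (1 / (x - z)) / x ^ (d + 2)
        + (1 / x + 1 / (y - x)) * (1 / (y - z)) / y ^ (d + 2)
        + (1 / x + 1 / (z - x)) * (1 / (z - y)) / z ^ (d + 2)"
proof -
  have nonzero: "x - y \<noteq> 0" "x - z \<noteq> 0" "y - z \<noteq> 0" "y - x \<noteq> 0" "z - x \<noteq> 0" "z - y \<noteq> 0"
    using assms by auto
  have diff: "1 / x - 1 / y = (y - x) / (x * y)" "1 / x - 1 / z = (z - x) / (x * z)"
    "1 / y - 1 / z = (z - y) / (y * z)" "1 / y - 1 / x = (x - y) / (x * y)"
    "1 / z - 1 / x = (x - z) / (x * z)" "1 / z - 1 / y = (y - z) / (y * z)"
    using assms by (simp_all add: field_simps)
  have coeffs: "(1 / x) ^ 2 * (1 / y) * (1 / z) * (X / ((y - x) / (x * y) * ((z - x) / (x * z))))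
      = 1 / (x - y) * (1 / (x - z)) * X"
    "(1 / x) ^ 2 * (1 / y) * (1 / z) * (X / ((x - y) / (x * y) * ((z - y) / (y * z))))
      = (1 / x + 1 / (y - x)) * (1 / (y - z)) * X"
    "(1 / x) ^ 2 * (1 / y) * (1 / z) * (X / ((x - z) / (x * z) * ((y - z) / (y * z))))
      = (1 / x + 1 / (z - x)) * (1 / (z - y)) * X" for X
    using assms(1-3) nonzero by (simp_all add: divide_simps power2_eq_square) algebra+
  have "weight_sum (d + 4) x y z
      = (\<Sum>(a, b, c)\<in>weight_triples (d + 4). (1 / x) ^ a * (1 / y) ^ b * (1 / z) ^ c)"
    by (simp add: weight_sum_def power_one_over)
  also have "\<dots> = (1 / x) ^ 2 * (1 / y) * (1 / z) *
      ((1 / x) ^ (d + 2) / ((1 / x - 1 / y) * (1 / x - 1 / z))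
        + (1 / y) ^ (d + 2) / ((1 / y - 1 / x) * (1 / y - 1 / z))
        + (1 / z) ^ (d + 2) / ((1 / z - 1 / x) * (1 / z - 1 / y)))"
    unfolding sum_weight_triples
    using assms by (subst complete_homogeneous_partial_fractions) simp_all
  also have "\<dots> = 1 / (x - y) * (1 / (x - z)) / x ^ (d + 2)
        + (1 / x + 1 / (y - x)) * (1 / (y - z)) / y ^ (d + 2)
        + (1 / x + 1 / (z - x)) * (1 / (z - y)) / z ^ (d + 2)"
    unfolding diff distrib_left coeffs by (simp add: power_one_over)
  finally show ?thesis .
qed

definition signed_weight_sum :: "nat \<Rightarrow> real \<Rightarrow> real \<Rightarrow> real \<Rightarrow> real" where
  "signed_weight_sum w x y z
     = (\<Sum>(a, b, c)\<in>weight_triples w. ((-1) ^ c - (-1) ^ a) * (1 / (x ^ a * y ^ b * z ^ c)))"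

lemma signed_weight_sum_eq_diff:
  assumes "even w"
  shows   "signed_weight_sum w x y z = weight_sum w x y (- z) - weight_sum w x (- y) (- z)"
  unfolding signed_weight_sum_def weight_sum_def sum_subtractf[symmetric]
proof (intro sum.cong refl, clarify)
  fix a b c assume "(a, b, c) \<in> weight_triples w"
  hence "even (a + b + c)" using assms by (simp add: weight_triples_def)
  hence "(-1 :: real) ^ a = (-1) ^ (b + c)" by (auto simp: minus_one_power_iff)
  thus "((-1) ^ c - (-1) ^ a) * (1 / (x ^ a * y ^ b * z ^ c))
      = 1 / (x ^ a * y ^ b * (- z) ^ c) - 1 / (x ^ a * (- y) ^ b * (- z) ^ c)"
    by (auto simp: power_minus[of y] power_minus[of z] power_add minus_one_power_iff)
qed

definition largest_coeff :: "real \<Rightarrow> real \<Rightarrow> real \<Rightarrow> real" where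
  "largest_coeff x y z = (1 / (x - y) - 1 / (x + y)) * (1 / (x + z))"

definition middle_sum_coeff :: "real \<Rightarrow> real \<Rightarrow> real \<Rightarrow> real" where
  "middle_sum_coeff x y z = (1 / (x - y) - 1 / x) * (1 / (y + z))"

definition middle_diff_coeff :: "real \<Rightarrow> real \<Rightarrow> real \<Rightarrow> real" where
  "middle_diff_coeff x y z = (1 / x - 1 / (x + y)) * (1 / (y - z))"

definition smallest_coeff :: "real \<Rightarrow> real \<Rightarrow> real \<Rightarrow> real" where
  "smallest_coeff x y z = (1 / (y - z) + 1 / (y + z)) * (1 / x - 1 / (x + z))"

lemma signed_weight_sum_partial_fractions:
  assumes "even d" "0 < z" "z < y" "y < x"
  shows "signed_weight_sum (d + 4) x y z
      = largest_coeff x y z / x ^ (d + 2) - middle_sum_coeff x y z / y ^ (d + 2)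
        + middle_diff_coeff x y z / y ^ (d + 2) - smallest_coeff x y z / z ^ (d + 2)"
proof -
  have "1 / (- z - x) = - (1 / (x + z))" "1 / (- z - y) = - (1 / (y + z))"
    "1 / (- y - x) = - (1 / (x + y))" "1 / (- y - - z) = - (1 / (y - z))" "1 / (- z - - y) = 1 / (y - z)"
    "1 / (y - x) = - (1 / (x - y))" "(- y) ^ (d + 2) = y ^ (d + 2)" "(- z) ^ (d + 2) = z ^ (d + 2)"
    using assms by (simp_all add: divide_simps)
  moreover have "signed_weight_sum (d + 4) x y z
      = weight_sum (d + 4) x y (- z) - weight_sum (d + 4) x (- y) (- z)"
    using assms(1) by (intro signed_weight_sum_eq_diff) simp
  moreover have "weight_sum (d + 4) x y (- z)
      = 1 / (x - y) * (1 / (x - - z)) / x ^ (d + 2)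
        + (1 / x + 1 / (y - x)) * (1 / (y - - z)) / y ^ (d + 2)
        + (1 / x + 1 / (- z - x)) * (1 / (- z - y)) / (- z) ^ (d + 2)"
    using assms by (intro weight_sum_partial_fractions) auto
  moreover have "weight_sum (d + 4) x (- y) (- z)
      = 1 / (x - - y) * (1 / (x - - z)) / x ^ (d + 2)
        + (1 / x + 1 / (- y - x)) * (1 / (- y - - z)) / (- y) ^ (d + 2)
        + (1 / x + 1 / (- z - x)) * (1 / (- z - - y)) / (- z) ^ (d + 2)"
    using assms by (intro weight_sum_partial_fractions) auto
  ultimately show ?thesis
    unfolding largest_coeff_def middle_sum_coeff_def middle_diff_coeff_def smallest_coeff_def
    by (simp only: diff_minus_eq_add) (simp add: algebra_simps diff_divide_distrib add_divide_distrib)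
qed

subsection \<open>Summing the coefficients\<close>

lemma weighted_harm_diff_expansion:
  assumes "N \<ge> 1"
  shows "(1 / real p + 1 / (real p + real (2 * N))) * (harm (p + N + N) - harm (p + N))
    = (\<Sum>j=1..N. 1 / real p * (1 / (real p + real (N + j))))
      + ((\<Sum>j=1..<N. 1 / (real p + real (N + j)) * (1 / (real p + real (2 * N))))
         + 1 / (real p + real (2 * N)) ^ 2)"
proof -
  define d where "d = 1 / (real p + real (2 * N))"
  have full: "harm (p + N + N) - harm (p + N) = (\<Sum>j=1..N. 1 / (real p + real (N + j)))"
    using sum_inverse_add[of "Suc N" "p + N"]
    by (simp add: atLeastLessThanSuc_atLeastAtMost add_ac)
  have split_last: "(\<Sum>j=1..N. 1 / (real p + real (N + j))) = (\<Sum>j=1..<N. 1 / (real p + real (N + j))) + d"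
    using assms by (cases N) (simp_all add: atLeastLessThanSuc_atLeastAtMost d_def)
  have "(1 / real p + d) * (harm (p + N + N) - harm (p + N))
    = 1 / real p * (harm (p + N + N) - harm (p + N)) + (harm (p + N + N) - harm (p + N)) * d"
    by (simp add: algebra_simps)
  also have "1 / real p * (harm (p + N + N) - harm (p + N))
    = (\<Sum>j=1..N. 1 / real p * (1 / (real p + real (N + j))))"
    by (simp only: full sum_distrib_left)
  also have "(harm (p + N + N) - harm (p + N)) * d
    = (\<Sum>j=1..<N. 1 / (real p + real (N + j)) * d) + d ^ 2"
    by (simp only: full split_last distrib_right sum_distrib_right power2_eq_square)
  finally show ?thesis by (simp only: d_def power_one_over)
qed

lemma has_sum_weighted_harm_diff:
  assumes "N \<ge> 1"
  shows "((\<lambda>p. (1 / real p + 1 / (real p + real (2 * N))) * (harm (p + N + N) - harm (p + N)))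
           has_sum (mzv [2] + (harm (2 * N) - harm N) * harm (N - 1) - gen_harm 2 N / 2)) {0<..}"
proof -
  have near: "((\<lambda>p. \<Sum>j=1..N. 1 / real p * (1 / (real p + real (N + j)))) has_sum
      (\<Sum>j=1..N. harm (N + j) / (real N + real j))) {0<..}"
  proof (rule has_sum_sum)
    fix j assume "j \<in> {1..N}"
    thus "((\<lambda>p. 1 / real p * (1 / (real p + real (N + j)))) has_sum harm (N + j) / (real N + real j)) {0<..}"
      using has_sum_inverse_product[of 0 "N + j"] by (simp add: harm_expand)
  qed simp
  have far: "((\<lambda>p. \<Sum>j=1..<N. 1 / (real p + real (N + j)) * (1 / (real p + real (2 * N)))) has_sum
      (\<Sum>j=1..<N. (harm (2 * N) - harm (N + j)) / (real N - real j))) {0<..}"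
  proof (rule has_sum_sum)
    fix j assume "j \<in> {1..<N}"
    thus "((\<lambda>p. 1 / (real p + real (N + j)) * (1 / (real p + real (2 * N)))) has_sum
        (harm (2 * N) - harm (N + j)) / (real N - real j)) {0<..}"
      using has_sum_inverse_product[of "N + j" "2 * N"] by simp
  qed simp
  have diagonal: "((\<lambda>p. 1 / (real p + real (2 * N)) ^ 2) has_sum (mzv [2] - gen_harm 2 (2 * N))) {0<..}"
    by (rule has_sum_mzv_single_shift) simp
  have "(\<Sum>j=1..N. harm (N + j) / (real N + real j))
      + ((\<Sum>j=1..<N. (harm (2 * N) - harm (N + j)) / (real N - real j)) + (mzv [2] - gen_harm 2 (2 * N)))
    = mzv [2] + (harm (2 * N) - harm N) * harm (N - 1) - gen_harm 2 N / 2"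
    using sum_harm_div_add_harm_diff[OF assms] by simp
  with has_sum_add[OF near has_sum_add[OF far diagonal]] show ?thesis
    by (simp only: weighted_harm_diff_expansion[OF assms])
qed

lemma has_sum_smallest_coeff_fibre:
  assumes "N \<ge> 1"
  shows "((\<lambda>(m, k). smallest_coeff (real k) (real m) (real N)) has_sum
           (mzv [2] + (harm (2 * N) - harm N) * harm (N - 1) - gen_harm 2 N / 2))
         (SIGMA m:{N<..}. {m<..})"
proof (rule has_sum_SigmaI_nonneg)
  fix m assume "m \<in> {N<..}"
  have "((\<lambda>p. 1 / real (m + p) - 1 / (real (m + p) + real N)) has_sum (harm (m + N) - harm m)) {0<..}"
    using has_sum_inverse_diff[of m "m + N"] by (simp add: add_ac)
  hence "((\<lambda>k. 1 / real k - 1 / (real k + real N)) has_sum (harm (m + N) - harm m)) {m<..}"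
    unfolding has_sum_greaterThan_shift[where m = m] .
  thus "((\<lambda>k. case (m, k) of (m, k) \<Rightarrow> smallest_coeff (real k) (real m) (real N)) has_sum
      (1 / (real m - real N) + 1 / (real m + real N)) * (harm (m + N) - harm m)) {m<..}"
    by (simp add: smallest_coeff_def has_sum_cmult_right)
next
  show "((\<lambda>m. (1 / (real m - real N) + 1 / (real m + real N)) * (harm (m + N) - harm m))
      has_sum (mzv [2] + (harm (2 * N) - harm N) * harm (N - 1) - gen_harm 2 N / 2)) {N<..}"
    unfolding has_sum_greaterThan_shift[where m = N]
    using has_sum_weighted_harm_diff[OF assms] by (simp add: add_ac)
qed (auto simp: smallest_coeff_def frac_le)

lemma has_sum_largest_coeff:
  assumes "2 \<le> s"
  obtains S where
    "((\<lambda>(k, m, n). largest_coeff (real k) (real m) (real n) / real k ^ s) has_sum S) index_triples"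
    "((\<lambda>N. (harm N * (harm (2 * N - 1) - harm N) - gen_harm 2 (N - 1) / 2) / real N ^ s) has_sum S) {0<..}"
proof -
  define f where "f k = (\<lambda>(m, n). largest_coeff (real k) (real m) (real n))" for k :: nat
  define g where "g N = harm N * (harm (2 * N - 1) - harm N) - gen_harm 2 (N - 1) / 2" for N
  define B where "B k = (SIGMA m:{1..<k}. {1..<m})" for k :: nat
  obtain S where fibres: "((\<lambda>(k, y). f k y / real k ^ s) has_sum S) (Sigma {0<..} B)"
    and g: "((\<lambda>N. g N / real N ^ s) has_sum S) {0<..}"
  proof (rule has_sum_Sigma_div_power[OF assms, of f B g])
    fix k :: nat assume pos: "0 < k"
    have "sum (f k) (B k) = (\<Sum>m=1..<k. (1 / (real k - real m) - 1 / (real k + real m))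
        * (\<Sum>n=1..<m. 1 / (real k + real n)))"
      by (simp add: f_def B_def largest_coeff_def sum_distrib_left flip: sum.Sigma)
    also have "\<dots> = (\<Sum>m=1..<k. (1 / (real k - real m) - 1 / (real k + real m)) * (harm (k + m - 1) - harm k))"
      by (rule sum.cong[OF refl], subst sum_inverse_add) auto
    also have "\<dots> = g k"
      unfolding g_def using pos by (intro sum_harm_diff_weighted) auto
    finally show "(f k has_sum g k) (B k)" by (simp add: B_def has_sum_finite_iff)
    show "g k \<le> 1 * harm k ^ 2"
      using mult_harm_le_harm_squared[OF _ harm_double_pred_diff_le, of k k] gen_harm_nonneg[of 2 "k - 1"] pos
      by (simp add: g_def mult.commute)
  qed (auto simp: f_def B_def largest_coeff_def frac_le)
  show ?thesis
  proof (rule that)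
    show "((\<lambda>(k, m, n). largest_coeff (real k) (real m) (real n) / real k ^ s) has_sum S) index_triples"
      using fibres unfolding has_sum_index_triples_largest_first f_def B_def
      by (simp add: case_prod_unfold)
  qed (use g in \<open>simp add: g_def\<close>)
qed

lemma has_sum_middle_product:
  fixes f g :: "nat \<Rightarrow> nat \<Rightarrow> real"
  assumes "2 \<le> s"
    and sum_f: "\<And>m. 0 < m \<Longrightarrow> (f m has_sum F m) {m<..}"
    and sum_g: "\<And>m. 0 < m \<Longrightarrow> (\<Sum>n=1..<m. g m n) = G m"
    and nonneg: "\<And>m k. 0 < m \<Longrightarrow> m < k \<Longrightarrow> 0 \<le> f m k" "\<And>m n. 0 < n \<Longrightarrow> n < m \<Longrightarrow> 0 \<le> g m n"
    and bound: "\<And>m. 0 < m \<Longrightarrow> F m * G m \<le> harm m ^ 2"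
  obtains S where
    "((\<lambda>(k, m, n). f m k * g m n / real m ^ s) has_sum S) index_triples"
    "((\<lambda>N. F N * G N / real N ^ s) has_sum S) {0<..}"
proof -
  obtain S where fibres: "((\<lambda>(m, y). (case y of (k, n) \<Rightarrow> f m k * g m n) / real m ^ s) has_sum S)
      (SIGMA m:{0<..}. {m<..} \<times> {1..<m})"
    and FG: "((\<lambda>N. F N * G N / real N ^ s) has_sum S) {0<..}"
  proof (rule has_sum_Sigma_div_power[OF assms(1)])
    fix m :: nat assume pos: "0 < m"
    show "((\<lambda>(k, n). f m k * g m n) has_sum F m * G m) ({m<..} \<times> {1..<m})"
      unfolding sum_g[OF pos, symmetric] using pos
      by (intro has_sum_Times_nonneg sum_f has_sum_finite) (auto simp: nonneg)
    show "F m * G m \<le> 1 * harm m ^ 2" using bound[OF pos] by simp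
  qed (auto simp: nonneg)
  show ?thesis
  proof (rule that)
    show "((\<lambda>(k, m, n). f m k * g m n / real m ^ s) has_sum S) index_triples"
      using fibres unfolding has_sum_index_triples_middle_first
      by (simp add: case_prod_unfold)
  qed (use FG in assumption)
qed

lemma has_sum_middle_sum_coeff:
  assumes "2 \<le> s"
  obtains S where
    "((\<lambda>(k, m, n). middle_sum_coeff (real k) (real m) (real n) / real m ^ s) has_sum S) index_triples"
    "((\<lambda>N. harm N * (harm (2 * N - 1) - harm N) / real N ^ s) has_sum S) {0<..}"
proof (rule has_sum_middle_product[OF assms,
    of "\<lambda>m k. 1 / (real k - real m) - 1 / real k" harm "\<lambda>m n. 1 / (real m + real n)"
       "\<lambda>m. harm (2 * m - 1) - harm m"])
  fix m :: nat assume pos: "0 < m"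
  show "((\<lambda>k. 1 / (real k - real m) - 1 / real k) has_sum harm m) {m<..}"
    unfolding has_sum_greaterThan_shift[where m = m]
    using has_sum_inverse_diff[of 0 m] by (simp add: harm_expand add.commute)
  show "(\<Sum>n=1..<m. 1 / (real m + real n)) = harm (2 * m - 1) - harm m"
    unfolding mult_2 using pos by (intro sum_inverse_add) simp
  show "harm m * (harm (2 * m - 1) - harm m) \<le> (harm m ^ 2 :: real)"
    using mult_harm_le_harm_squared[OF _ harm_double_pred_diff_le, of m m] pos by (simp add: mult.commute)
qed (auto simp: middle_sum_coeff_def frac_le that)

lemma has_sum_middle_diff_coeff:
  assumes "2 \<le> s"
  obtains S where
    "((\<lambda>(k, m, n). middle_diff_coeff (real k) (real m) (real n) / real m ^ s) has_sum S) index_triples"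
    "((\<lambda>N. (harm (2 * N) - harm N) * harm (N - 1) / real N ^ s) has_sum S) {0<..}"
proof (rule has_sum_middle_product[OF assms,
    of "\<lambda>m k. 1 / real k - 1 / (real k + real m)" "\<lambda>m. harm (2 * m) - harm m"
       "\<lambda>m n. 1 / (real m - real n)" "\<lambda>m. harm (m - 1)"])
  fix m :: nat assume pos: "0 < m"
  show "((\<lambda>k. 1 / real k - 1 / (real k + real m)) has_sum (harm (2 * m) - harm m)) {m<..}"
    unfolding has_sum_greaterThan_shift[where m = m]
    using has_sum_inverse_diff[of m "2 * m"] by (simp add: add_ac)
  show "(\<Sum>n=1..<m. 1 / (real m - real n)) = harm (m - 1)"
    by (rule sum_inverse_diff)
  have "(harm (2 * m) - harm m) * harm (m - 1) \<le> (harm (2 * m) - harm m) * (harm m :: real)"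
    by (intro mult_left_mono) (auto simp: harm_mono)
  also have "\<dots> \<le> harm m ^ 2"
    using pos by (intro mult_harm_le_harm_squared harm_double_diff_le) auto
  finally show "(harm (2 * m) - harm m) * harm (m - 1) \<le> (harm m ^ 2 :: real)" .
qed (auto simp: middle_diff_coeff_def frac_le that)

lemma has_sum_smallest_coeff:
  assumes "2 \<le> s"
  obtains S where
    "((\<lambda>(k, m, n). smallest_coeff (real k) (real m) (real n) / real n ^ s) has_sum S) index_triples"
    "((\<lambda>N. (mzv [2] + (harm (2 * N) - harm N) * harm (N - 1) - gen_harm 2 N / 2) / real N ^ s)
       has_sum S) {0<..}"
proof -
  define f where "f n = (\<lambda>(m, k). smallest_coeff (real k) (real m) (real n))" for n :: nat
  define g where "g N = mzv [2] + (harm (2 * N) - harm N) * harm (N - 1) - gen_harm 2 N / 2" for N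
  define B where "B n = (SIGMA m:{n<..}. {m<..})" for n :: nat
  obtain S where fibres: "((\<lambda>(n, y). f n y / real n ^ s) has_sum S) (Sigma {0<..} B)"
    and g: "((\<lambda>N. g N / real N ^ s) has_sum S) {0<..}"
  proof (rule has_sum_Sigma_div_power[OF assms, of f B g])
    fix n :: nat assume pos: "0 < n"
    show "(f n has_sum g n) (B n)"
      unfolding f_def g_def B_def using pos by (intro has_sum_smallest_coeff_fibre) auto
    have "0 \<le> mzv [2]" by (rule has_sum_nonneg[OF has_sum_mzv_single]) auto
    hence "mzv [2] * 1 \<le> mzv [2] * harm n ^ 2"
      using harm_ge_1[OF pos] by (intro mult_left_mono one_le_power) auto
    moreover have "(harm (2 * n) - harm n) * harm (n - 1) \<le> (harm (2 * n) - harm n) * (harm n :: real)"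
      by (intro mult_left_mono) (auto simp: harm_mono)
    ultimately show "g n \<le> (mzv [2] + 1) * harm n ^ 2"
      using mult_harm_le_harm_squared[of n "harm (2 * n) - harm n"] harm_double_diff_le[of n]
        gen_harm_nonneg[of 2 n] pos
      by (simp add: g_def distrib_right)
  qed (auto simp: f_def B_def smallest_coeff_def frac_le)
  show ?thesis
  proof (rule that)
    show "((\<lambda>(k, m, n). smallest_coeff (real k) (real m) (real n) / real n ^ s) has_sum S) index_triples"
      using fibres unfolding has_sum_index_triples_smallest_first f_def B_def
      by (simp add: case_prod_unfold)
  qed (use g in \<open>simp add: g_def\<close>)
qed

lemma has_sum_total_coefficient:
  assumes "2 \<le> s"
  shows "((\<lambda>N. (1 / (2 * real N ^ 2) - mzv [2]) / real N ^ s)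
           has_sum (1 / 2 * mzv [s + 2] - mzv [2] * mzv [s])) {0<..}"
proof -
  have "((\<lambda>N. 1 / 2 * (1 / real N ^ (s + 2)) - mzv [2] * (1 / real N ^ s))
      has_sum (1 / 2 * mzv [s + 2] - mzv [2] * mzv [s])) {0<..}"
    using assms by (intro has_sum_diff has_sum_cmult_right has_sum_mzv_single) auto
  also have "(\<lambda>N. 1 / 2 * (1 / real N ^ (s + 2)) - mzv [2] * (1 / real N ^ s))
      = (\<lambda>N. (1 / (2 * real N ^ 2) - mzv [2]) / real N ^ s)"
    by (simp add: fun_eq_iff power_add power2_eq_square diff_divide_distrib mult_ac)
  finally show ?thesis .
qed

lemma has_sum_coeffs:
  assumes "2 \<le> s"
  shows "((\<lambda>(k, m, n).
      largest_coeff (real k) (real m) (real n) / real k ^ s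
      - middle_sum_coeff (real k) (real m) (real n) / real m ^ s
      + middle_diff_coeff (real k) (real m) (real n) / real m ^ s
      - smallest_coeff (real k) (real m) (real n) / real n ^ s)
    has_sum (1 / 2 * mzv [s + 2] - mzv [2] * mzv [s])) index_triples"
proof -
  define P where "P N = harm N * (harm (2 * N - 1) - harm N :: real)" for N
  define Q where "Q N = (harm (2 * N) - harm N) * (harm (N - 1) :: real)" for N
  obtain S where largest:
    "((\<lambda>(k, m, n). largest_coeff (real k) (real m) (real n) / real k ^ s) has_sum S) index_triples"
    "((\<lambda>N. (P N - gen_harm 2 (N - 1) / 2) / real N ^ s) has_sum S) {0<..}"
    unfolding P_def by (rule has_sum_largest_coeff[OF assms])
  obtain T where middle_sum:
    "((\<lambda>(k, m, n). middle_sum_coeff (real k) (real m) (real n) / real m ^ s) has_sum T) index_triples"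
    "((\<lambda>N. P N / real N ^ s) has_sum T) {0<..}"
    unfolding P_def by (rule has_sum_middle_sum_coeff[OF assms])
  obtain U where middle_diff:
    "((\<lambda>(k, m, n). middle_diff_coeff (real k) (real m) (real n) / real m ^ s) has_sum U) index_triples"
    "((\<lambda>N. Q N / real N ^ s) has_sum U) {0<..}"
    unfolding Q_def by (rule has_sum_middle_diff_coeff[OF assms])
  obtain V where smallest:
    "((\<lambda>(k, m, n). smallest_coeff (real k) (real m) (real n) / real n ^ s) has_sum V) index_triples"
    "((\<lambda>N. (mzv [2] + Q N - gen_harm 2 N / 2) / real N ^ s) has_sum V) {0<..}"
    unfolding Q_def by (rule has_sum_smallest_coeff[OF assms])
  have "(P N - gen_harm 2 (N - 1) / 2) / real N ^ s - P N / real N ^ s + Q N / real N ^ s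
        - (mzv [2] + Q N - gen_harm 2 N / 2) / real N ^ s
      = (1 / (2 * real N ^ 2) - mzv [2]) / real N ^ s" if "N \<in> {0<..}" for N
  proof -
    have "gen_harm 2 N = gen_harm 2 (N - 1) + 1 / real N ^ 2"
      using that by (cases N) (simp_all add: gen_harm_Suc)
    thus ?thesis by (simp add: add_divide_distrib diff_divide_distrib)
  qed
  hence "((\<lambda>N. (1 / (2 * real N ^ 2) - mzv [2]) / real N ^ s) has_sum (S - T + U - V)) {0<..}"
    using has_sum_diff[OF has_sum_add[OF has_sum_diff[OF largest(2) middle_sum(2)] middle_diff(2)]
        smallest(2)]
    by (subst (asm) has_sum_cong) auto
  hence "S - T + U - V = 1 / 2 * mzv [s + 2] - mzv [2] * mzv [s]"
    using has_sum_total_coefficient[OF assms] by (rule has_sum_unique)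
  thus ?thesis
    using has_sum_diff[OF has_sum_add[OF has_sum_diff[OF largest(1) middle_sum(1)] middle_diff(1)]
        smallest(1)]
    by (simp add: case_prod_unfold)
qed

lemma has_sum_signed_weight_sum_mzv:
  "((\<lambda>(k, m, n). signed_weight_sum w (real k) (real m) (real n)) has_sum
     (\<Sum>(a, b, c)\<in>weight_triples w. ((-1) ^ c - (-1) ^ a) * mzv [a, b, c])) index_triples"
proof -
  define t where "t = (\<lambda>(a, b, c) (k, m, n).
    ((-1) ^ c - (-1) ^ a) * (1 / (real k ^ a * real m ^ b * real n ^ c)))"
  have "((\<lambda>x. \<Sum>y\<in>weight_triples w. t y x) has_sum
      (\<Sum>(a, b, c)\<in>weight_triples w. ((-1) ^ c - (-1) ^ a) * mzv [a, b, c])) index_triples"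
  proof (rule has_sum_sum[OF finite_weight_triples], clarify)
    fix a b c assume "(a, b, c) \<in> weight_triples w"
    hence "((\<lambda>(k, m, n). 1 / (real k ^ a * real m ^ b * real n ^ c)) has_sum mzv [a, b, c]) index_triples"
      by (intro has_sum_mzv_triple) (auto simp: weight_triples_def)
    from has_sum_cmult_right[OF this, of "(-1) ^ c - (-1) ^ a"]
    show "(t (a, b, c) has_sum ((-1) ^ c - (-1) ^ a) * mzv [a, b, c]) index_triples"
      by (simp add: t_def case_prod_unfold)
  qed
  thus ?thesis by (simp add: t_def signed_weight_sum_def case_prod_unfold)
qed

lemma has_sum_signed_weight_sum:
  assumes "even d"
  shows "((\<lambda>(k, m, n). signed_weight_sum (d + 4) (real k) (real m) (real n)) has_sum
           (1 / 2 * mzv [d + 4] - mzv [2] * mzv [d + 2])) index_triples"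
proof -
  have weight: "d + 2 + 2 = d + 4" by simp
  have "((\<lambda>(k, m, n).
      largest_coeff (real k) (real m) (real n) / real k ^ (d + 2)
      - middle_sum_coeff (real k) (real m) (real n) / real m ^ (d + 2)
      + middle_diff_coeff (real k) (real m) (real n) / real m ^ (d + 2)
      - smallest_coeff (real k) (real m) (real n) / real n ^ (d + 2))
    has_sum (1 / 2 * mzv [d + 2 + 2] - mzv [2] * mzv [d + 2])) index_triples"
    by (rule has_sum_coeffs) simp
  also have "?this \<longleftrightarrow> ((\<lambda>(k, m, n). signed_weight_sum (d + 4) (real k) (real m) (real n)) has_sum
      (1 / 2 * mzv [d + 2 + 2] - mzv [2] * mzv [d + 2])) index_triples"
    by (rule has_sum_cong, clarify, rule signed_weight_sum_partial_fractions[OF assms, symmetric])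
       (auto simp: index_triples_def)
  finally show ?thesis unfolding weight .
qed

theorem theorem5p5:
  fixes w u :: nat
  assumes "w \<ge> 4" and "even w" and "u = w - 2"
  shows "(\<Sum>(a, b, c)\<in>{(a, b, c). a + b + c = w \<and> a \<ge> 2 \<and> b \<ge> 1 \<and> c \<ge> 1}.
            ((-1) ^ c - (-1) ^ a) * mzv [a, b, c])
         = 1 / 2 * mzv [w] - mzv [2] * mzv [u]"
proof -
  obtain d where d: "w = d + 4" "even d"
    using assms by (metis dvd_add_left_iff even_numeral le_add_diff_inverse2)
  hence "((\<lambda>(k, m, n). signed_weight_sum w (real k) (real m) (real n)) has_sum
      (1 / 2 * mzv [w] - mzv [2] * mzv [u])) index_triples"
    using has_sum_signed_weight_sum[of d] assms(3) by simp
  with has_sum_signed_weight_sum_mzv[of w] show ?thesis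
    unfolding weight_triples_def by (rule has_sum_unique)
qed

end
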